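(* Let $(\Omega,F,P)$ be a probability space, and let $X_1,X_2,\dots$ and $X_\infty$ be random variables $\Omega\to\mathbb{R}^{**}$ that are finite almost everywhere, i.e. $P(X_n\in\mathbb{R})=1$ for every $n\ge 1$ and $P(X_\infty\in\mathbb{R})=1$. Let $A=(a_{ij})$, $i=1,2,\dots$, $j=0,1,2,\dots$, be a double sequence of real constants defining a regular method of summability, that is: 1. $\sup_{1\le i<\infty}\sum_{j=0}^{\infty}|a_{ij}|=M<\infty$; 2. $\lim_{i\to\infty}a_{ij}=0$ for each $j=1,2,\dots$; 3. $\lim_{i\to\infty}\sum_{j=1}^{\infty}a_{ij}=1$. Write $(Ax)_n=\sum_{j=1}^{\infty}a_{nj}X_j$ for $n=1,2,\dots$. If $X_n\to X_\infty$ a.e. in $\Omega$, then $(Ax)_n\to X_\infty$ a.e. in $\Omega$.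
   Context: Extended real numbers $\mathbb{R}^{**}$: let $\mathbb{R}^{**}$ be a 2-dimensional real vector space with basis $(1,\infty)$, so every element is uniquely $u=a+b\cdot\infty$ with $a,b\in\mathbb{R}$; $\mathbb{R}$ is identified with $\{a\cdot 1: a\in\mathbb{R}\}$. It carries the lexicographic order: $a+b\cdot\infty<c+d\cdot\infty$ iff $b<d$, or $b=d$ and $a<c$. The absolute value is $|a+b\cdot\infty|:=|a|+|b|\cdot\infty$, which on $\mathbb{R}$ is the usual one. Elements of $\mathbb{R}^{**}\setminus\mathbb{R}$ are called infinite. Here $x=(X_1,X_2,\dots)$ is the sequence of random variables. Since countably many a.e. finite random variables are simultaneously finite on a set of probability one, the a.e. statements (and the values of $(Ax)_n$) are only concerned with a full-measure set on which all $X_n$ and $X_\infty$ are real-valued; there convergence is the usual convergence of real numbers. What happens on a null set is irrelevant. *)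

theory Defs
  imports "HOL-Probability.Probability"
begin

text \<open>The extended reals \<open>\<real>**\<close>: \<open>XReal a b\<close> stands for \<open>a + b \<cdot> \<infinity>\<close>.\<close>

datatype xreal = XReal (fin_part: real) (inf_part: real)

instantiation xreal :: real_vector
begin

definition "0 = XReal 0 0"
definition "x + y = XReal (fin_part x + fin_part y) (inf_part x + inf_part y)"
definition "- x = XReal (- fin_part x) (- inf_part x)"
definition "x - y = XReal (fin_part x - fin_part y) (inf_part x - inf_part y)"
definition "c *\<^sub>R x = XReal (c * fin_part x) (c * inf_part x)"

instance
  by standard
    (simp_all add: zero_xreal_def plus_xreal_def uminus_xreal_def minus_xreal_def
      scaleR_xreal_def algebra_simps)

end

instantiation xreal :: "{one, infinity}"
begin

definition "1 = XReal 1 0"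
definition "\<infinity> = XReal 0 1"

instance ..

end

instantiation xreal :: linorder
begin

definition "x < y \<longleftrightarrow>
  inf_part x < inf_part y \<or> inf_part x = inf_part y \<and> fin_part x < fin_part y"
definition "x \<le> y \<longleftrightarrow> x < y \<or> x = (y::xreal)"

instance
  by standard (auto simp: less_xreal_def less_eq_xreal_def intro: xreal.expand)

end

instantiation xreal :: abs
begin

definition "\<bar>x\<bar> = XReal \<bar>fin_part x\<bar> \<bar>inf_part x\<bar>"

instance ..

end

text \<open>Limits and infinite series in \<open>\<real>**\<close> refer to the order topology; the lemmas
  \<open>tendsto_xreal_iff_abs\<close> and \<open>tendsto_real_xreal_iff\<close> below describe its convergence, in general
  and between real elements.\<close>

instantiation xreal :: linorder_topology
begin

definition "open = generate_topology (range lessThan \<union> range (greaterThan :: xreal \<Rightarrow> _))"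

instance
  by standard (simp add: open_xreal_def)

end

definition real_xreals :: "xreal set" where
  "real_xreals = range (\<lambda>a::real. a *\<^sub>R 1)"

text \<open>Random variables with values in \<open>\<real>**\<close> are measurable maps into the \<open>\<sigma>\<close>-algebra
  generated by the initial segments of the order.  This is strictly coarser than both the Borel
  \<open>\<sigma>\<close>-algebra of the order topology, in which every vertical line is open, and that of the plane;
  maps measurable for either of those are thus random variables in the present sense.\<close>

definition ray_algebra :: "xreal measure" where
  "ray_algebra = sigma UNIV (range lessThan)"

text \<open>The row index starts at 1, so row 0 is unconstrained.  The column index starts at 0 in the
  first condition and at 1 in the other two.\<close>

definition regular_method :: "(nat \<Rightarrow> nat \<Rightarrow> real) \<Rightarrow> bool" where
  "regular_method a \<longleftrightarrow>
     (SUP i\<in>{1..}. \<Sum>j. ennreal \<bar>a i j\<bar>) < \<infinity> \<and>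
     (\<forall>j\<ge>1. (\<lambda>i. a i j) \<longlonglongrightarrow> 0) \<and>
     (\<lambda>i. \<Sum>j. a i (Suc j)) \<longlonglongrightarrow> 1"

lemma xreal_decomp: "XReal a b = a *\<^sub>R 1 + b *\<^sub>R \<infinity>"
  by (simp add: one_xreal_def infinity_xreal_def plus_xreal_def scaleR_xreal_def)

lemma tendsto_xreal_iff_abs:
  fixes u :: "'a \<Rightarrow> xreal"
  shows "(u \<longlongrightarrow> l) F \<longleftrightarrow> (\<forall>e::real. e > 0 \<longrightarrow> (\<forall>\<^sub>F x in F. \<bar>u x - l\<bar> < e *\<^sub>R 1))"
proof
  assume lim: "(u \<longlongrightarrow> l) F"
  show "\<forall>e::real. e > 0 \<longrightarrow> (\<forall>\<^sub>F x in F. \<bar>u x - l\<bar> < e *\<^sub>R 1)"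
  proof (intro allI impI)
    fix e :: real assume e: "e > 0"
    have "l - e *\<^sub>R 1 < l" "l < l + e *\<^sub>R 1"
      using e by (simp_all add: less_xreal_def plus_xreal_def minus_xreal_def scaleR_xreal_def
        one_xreal_def)
    from order_tendstoD(1)[OF lim this(1)] order_tendstoD(2)[OF lim this(2)]
    show "\<forall>\<^sub>F x in F. \<bar>u x - l\<bar> < e *\<^sub>R 1"
      by eventually_elim
        (auto simp: less_xreal_def plus_xreal_def minus_xreal_def scaleR_xreal_def one_xreal_def
          abs_xreal_def)
  qed
next
  assume R: "\<forall>e::real. e > 0 \<longrightarrow> (\<forall>\<^sub>F x in F. \<bar>u x - l\<bar> < e *\<^sub>R 1)"
  have near: "\<forall>\<^sub>F x in F. inf_part (u x) = inf_part l \<and> \<bar>fin_part (u x) - fin_part l\<bar> < e"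
    if "e > 0" for e
    using R[rule_format, OF that]
    by eventually_elim
      (auto simp: less_xreal_def minus_xreal_def scaleR_xreal_def one_xreal_def abs_xreal_def)
  show "(u \<longlongrightarrow> l) F"
  proof (rule order_tendstoI)
    fix y assume y: "y < l"
    define e where "e = (if inf_part y = inf_part l then fin_part l - fin_part y else 1)"
    have "e > 0" using y by (auto simp: e_def less_xreal_def)
    from near[OF this] show "\<forall>\<^sub>F x in F. y < u x"
      by eventually_elim (use y in \<open>auto simp: e_def less_xreal_def split: if_splits\<close>)
  next
    fix y assume y: "l < y"
    define e where "e = (if inf_part y = inf_part l then fin_part y - fin_part l else 1)"
    have "e > 0" using y by (auto simp: e_def less_xreal_def)
    from near[OF this] show "\<forall>\<^sub>F x in F. u x < y"
      by eventually_elim (use y in \<open>auto simp: e_def less_xreal_def split: if_splits\<close>)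
  qed
qed

lemma tendsto_real_xreal_iff:
  fixes f :: "'a \<Rightarrow> real"
  shows "((\<lambda>x. f x *\<^sub>R (1::xreal)) \<longlongrightarrow> l *\<^sub>R 1) F \<longleftrightarrow> (f \<longlongrightarrow> l) F"
  unfolding tendsto_xreal_iff_abs tendsto_iff dist_real_def
  by (simp add: less_xreal_def minus_xreal_def scaleR_xreal_def one_xreal_def abs_xreal_def)

end

theory Submission
  imports Defs
begin

text \<open>
  On a set of probability one all \<open>X n\<close> with \<open>n \<ge> 1\<close> and \<open>Xinf\<close> are real, and \<open>X n \<omega>\<close> converges to
  \<open>Xinf \<omega>\<close>, so it suffices to fix such an \<open>\<omega>\<close>. The order topology of \<open>\<real>**\<close> induces the usual
  convergence on the line of real elements, and partial sums of real elements remain on that line;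
  so the claim becomes the Silverman--Toeplitz theorem for real sequences.

  The core of that theorem is the case of a null sequence \<open>y\<close>, in \<open>toeplitz_null\<close>. In
  \<open>\<Sum>j. b i j * y j\<close> the terms with large \<open>j\<close> are uniformly small in \<open>i\<close>, because \<open>y j\<close> is small
  and the absolute row sums are bounded; the finitely many remaining terms vanish in the limit,
  because every column of \<open>b\<close> does. A sequence with limit \<open>l\<close> is a null sequence plus the constant
  \<open>l\<close>, and the constant contributes \<open>l\<close> times the row sum, which tends to \<open>l\<close>.
\<close>

lemma summable_mult_convergent:
  fixes c x :: "nat \<Rightarrow> real"
  assumes "summable (\<lambda>j. \<bar>c j\<bar>)" and "x \<longlonglongrightarrow> l"
  shows "summable (\<lambda>j. \<bar>c j * x j\<bar>)"
proof -
  obtain B where B: "\<And>j. \<bar>x j\<bar> \<le> B"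
    using convergent_imp_Bseq[OF convergentI[OF assms(2)]] by (auto simp: Bseq_def)
  have "summable (\<lambda>j. \<bar>c j\<bar> * B)"
    using assms(1) by (rule summable_mult2)
  then show ?thesis
    by (rule summable_comparison_test'[where N = 0]) (auto simp: abs_mult intro: mult_left_mono B)
qed

text \<open>The threshold \<open>N\<close> beyond which \<open>y\<close> is small depends on the bound \<open>C\<close> alone and not on the
  row; this is what lets the head of the series be treated as a finite sum of null columns.\<close>

lemma toeplitz_null:
  fixes b :: "'i \<Rightarrow> nat \<Rightarrow> real" and y :: "nat \<Rightarrow> real"
  assumes rows: "\<forall>\<^sub>F i in F. summable (\<lambda>j. \<bar>b i j\<bar>) \<and> (\<Sum>j. \<bar>b i j\<bar>) \<le> C"
    and cols: "\<And>j. ((\<lambda>i. b i j) \<longlongrightarrow> 0) F"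
    and y: "y \<longlonglongrightarrow> 0"
  shows "((\<lambda>i. \<Sum>j. b i j * y j) \<longlongrightarrow> 0) F"
proof (rule tendstoI)
  fix e :: real assume e: "e > 0"
  \<comment> \<open>The absolute value and the summand 1 keep \<open>d\<close> positive and well defined even when \<open>C \<le> 0\<close>.\<close>
  define d where "d = e / (2 * (\<bar>C\<bar> + 1))"
  have d: "d > 0" using e by (simp add: d_def add_nonneg_pos)
  have "d * C \<le> d * (\<bar>C\<bar> + 1)"
    using d by (intro mult_left_mono) auto
  also have "\<dots> = e / 2"
    by (simp add: d_def field_simps add_nonneg_pos)
  finally have dC: "d * C \<le> e / 2" .
  obtain N where N: "\<And>j. j \<ge> N \<Longrightarrow> \<bar>y j\<bar> < d"
    using LIMSEQ_D[OF y d] by auto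
  have "((\<lambda>i. \<Sum>j<N. b i j * y j) \<longlongrightarrow> (\<Sum>j<N. 0 * y j)) F"
    by (intro tendsto_intros cols)
  then have head: "\<forall>\<^sub>F i in F. \<bar>\<Sum>j<N. b i j * y j\<bar> < e / 2"
    using e by (auto dest: tendstoD[where e = "e / 2"])
  show "\<forall>\<^sub>F i in F. dist (\<Sum>j. b i j * y j) 0 < e"
    using rows head
  proof eventually_elim
    case (elim i)
    then have sb: "summable (\<lambda>j. \<bar>b i j\<bar>)" and bC: "(\<Sum>j. \<bar>b i j\<bar>) \<le> C"
      by auto
    have sby: "summable (\<lambda>j. \<bar>b i j * y j\<bar>)"
      by (rule summable_mult_convergent[OF sb y])
    have sbN: "summable (\<lambda>j. \<bar>b i (j + N)\<bar>)"
      using sb by (subst summable_iff_shift)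
    have sbyN: "summable (\<lambda>j. \<bar>b i (j + N) * y (j + N)\<bar>)"
      using sby by (subst summable_iff_shift)
    have "\<bar>\<Sum>j. b i (j + N) * y (j + N)\<bar> \<le> (\<Sum>j. \<bar>b i (j + N) * y (j + N)\<bar>)"
      by (rule summable_rabs[OF sbyN])
    also have "\<dots> \<le> (\<Sum>j. d * \<bar>b i (j + N)\<bar>)"
    proof (rule suminf_le[OF _ sbyN summable_mult[OF sbN]])
      fix j
      have "\<bar>b i (j + N)\<bar> * \<bar>y (j + N)\<bar> \<le> \<bar>b i (j + N)\<bar> * d"
        using N[of "j + N"] by (intro mult_left_mono) auto
      then show "\<bar>b i (j + N) * y (j + N)\<bar> \<le> d * \<bar>b i (j + N)\<bar>"
        by (simp add: abs_mult mult.commute)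
    qed
    also have "\<dots> = d * (\<Sum>j. \<bar>b i (j + N)\<bar>)"
      by (rule suminf_mult[OF sbN])
    also have "\<dots> \<le> d * (\<Sum>j. \<bar>b i j\<bar>)"
      using d suminf_split_initial_segment[OF sb, of N]
      by (intro mult_left_mono) (auto intro: sum_nonneg)
    also have "\<dots> \<le> d * C"
      using d bC by (intro mult_left_mono) auto
    also note dC
    finally have tail: "\<bar>\<Sum>j. b i (j + N) * y (j + N)\<bar> \<le> e / 2" .
    have "(\<Sum>j. b i j * y j) = (\<Sum>j. b i (j + N) * y (j + N)) + (\<Sum>j<N. b i j * y j)"
      by (rule suminf_split_initial_segment[OF summable_rabs_cancel[OF sby]])
    with tail elim show ?case
      by (simp add: dist_real_def)
  qed
qed

theorem silverman_toeplitz: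
  fixes b :: "'i \<Rightarrow> nat \<Rightarrow> real" and x :: "nat \<Rightarrow> real"
  assumes rows: "\<forall>\<^sub>F i in F. summable (\<lambda>j. \<bar>b i j\<bar>) \<and> (\<Sum>j. \<bar>b i j\<bar>) \<le> C"
    and cols: "\<And>j. ((\<lambda>i. b i j) \<longlongrightarrow> 0) F"
    and row_sums: "((\<lambda>i. \<Sum>j. b i j) \<longlongrightarrow> 1) F"
    and x: "x \<longlonglongrightarrow> l"
  shows "((\<lambda>i. \<Sum>j. b i j * x j) \<longlongrightarrow> l) F"
proof -
  have null: "(\<lambda>j. x j - l) \<longlonglongrightarrow> 0"
    using x by (simp add: LIM_zero)
  have "((\<lambda>i. (\<Sum>j. b i j * (x j - l)) + (\<Sum>j. b i j) * l) \<longlongrightarrow> 0 + 1 * l) F"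
    by (intro tendsto_intros toeplitz_null[OF rows cols null] row_sums)
  then have "((\<lambda>i. (\<Sum>j. b i j * (x j - l)) + (\<Sum>j. b i j) * l) \<longlongrightarrow> l) F"
    by simp
  moreover have "\<forall>\<^sub>F i in F. (\<Sum>j. b i j * (x j - l)) + (\<Sum>j. b i j) * l = (\<Sum>j. b i j * x j)"
    using rows
  proof eventually_elim
    case (elim i)
    then have sb: "summable (\<lambda>j. \<bar>b i j\<bar>)" by auto
    have "(\<Sum>j. b i j * (x j - l)) + (\<Sum>j. b i j) * l = (\<Sum>j. b i j * (x j - l) + b i j * l)"
      using summable_rabs_cancel[OF summable_mult_convergent[OF sb null]]
        summable_rabs_cancel[OF sb]
      by (simp add: suminf_add suminf_mult2 summable_mult2)
    then show ?case
      by (simp add: algebra_simps)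
  qed
  ultimately show ?thesis
    by (rule Lim_transform_eventually)
qed

text \<open>The extended supremum of the absolute row sums, finite by regularity, yields summability of
  the rows together with a real bound. The shift by one removes column 0, which enters that
  condition but not the transform; dropping a nonnegative term only decreases the sum.\<close>

lemma regular_method_rows:
  assumes "regular_method a"
  shows "\<exists>C. \<forall>i\<ge>1. summable (\<lambda>j. \<bar>a i (Suc j)\<bar>) \<and> (\<Sum>j. \<bar>a i (Suc j)\<bar>) \<le> C"
proof -
  define S where "S = (SUP i\<in>{1..}. \<Sum>j. ennreal \<bar>a i j\<bar>)"
  have S: "S < \<infinity>" using assms by (simp add: regular_method_def S_def)
  show ?thesis
  proof (intro exI allI impI)
    fix i :: nat assume "i \<ge> 1"
    then have le: "(\<Sum>j. ennreal \<bar>a i j\<bar>) \<le> S"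
      unfolding S_def by (intro SUP_upper) auto
    then have "(\<Sum>j. ennreal \<bar>a i j\<bar>) \<noteq> top"
      using S by (auto simp: less_top top_unique)
    then have s: "summable (\<lambda>j. \<bar>a i j\<bar>)"
      by (intro summable_suminf_not_top) auto
    have "ennreal (\<Sum>j. \<bar>a i j\<bar>) \<le> S"
      using le by (simp add: suminf_ennreal2[OF _ s])
    then have "enn2real (ennreal (\<Sum>j. \<bar>a i j\<bar>)) \<le> enn2real S"
      using S by (intro enn2real_mono) auto
    then have "(\<Sum>j. \<bar>a i j\<bar>) \<le> enn2real S"
      using suminf_nonneg[OF s] by simp
    then show "summable (\<lambda>j. \<bar>a i (Suc j)\<bar>) \<and> (\<Sum>j. \<bar>a i (Suc j)\<bar>) \<le> enn2real S"
      using s suminf_split_head[OF s] by (auto simp: summable_Suc_iff[of "\<lambda>j. \<bar>a i j\<bar>"])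
  qed
qed

lemma sums_real_xreal:
  fixes f :: "nat \<Rightarrow> real"
  assumes "f sums s"
  shows "(\<lambda>j. f j *\<^sub>R (1::xreal)) sums (s *\<^sub>R 1)"
  using assms unfolding sums_def
  by (simp add: scaleR_left.sum[symmetric] tendsto_real_xreal_iff)

text \<open>A set outside the \<open>\<sigma>\<close>-algebra has \<open>measure\<close> 0 by convention, so a set of \<open>measure\<close> 1 is
  an event.\<close>

lemma (in prob_space) AE_if_measure_eq_1:
  assumes "measure M {\<omega> \<in> space M. P \<omega>} = 1"
  shows "AE \<omega> in M. P \<omega>"
proof -
  have "{\<omega> \<in> space M. P \<omega>} \<in> sets M"
    using assms measure_notin_sets by fastforce
  then show ?thesis
    using AE_prob_1[OF assms] by auto
qed

theorem proposition3p1: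
  fixes M :: "'w measure"
    and X :: "nat \<Rightarrow> 'w \<Rightarrow> xreal"
    and Xinf :: "'w \<Rightarrow> xreal"
    and a :: "nat \<Rightarrow> nat \<Rightarrow> real"
  assumes "prob_space M"
    and "\<And>n. n \<ge> 1 \<Longrightarrow> X n \<in> measurable M ray_algebra"
    and "Xinf \<in> measurable M ray_algebra"
    and "\<And>n. n \<ge> 1 \<Longrightarrow> measure M {\<omega> \<in> space M. X n \<omega> \<in> real_xreals} = 1"
    and "measure M {\<omega> \<in> space M. Xinf \<omega> \<in> real_xreals} = 1"
    and "regular_method a"
    and "AE \<omega> in M. (\<lambda>n. X n \<omega>) \<longlonglongrightarrow> Xinf \<omega>"
  shows "AE \<omega> in M. (\<forall>n\<ge>1. summable (\<lambda>j. a n (Suc j) *\<^sub>R X (Suc j) \<omega>)) \<and>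
           (\<lambda>n. \<Sum>j. a n (Suc j) *\<^sub>R X (Suc j) \<omega>) \<longlonglongrightarrow> Xinf \<omega>"
proof -
  interpret prob_space M by fact
  obtain C where rows:
    "\<forall>i\<ge>1. summable (\<lambda>j. \<bar>a i (Suc j)\<bar>) \<and> (\<Sum>j. \<bar>a i (Suc j)\<bar>) \<le> C"
    using regular_method_rows[OF \<open>regular_method a\<close>] by blast
  have cols: "(\<lambda>i. a i (Suc j)) \<longlonglongrightarrow> 0" for j
    using \<open>regular_method a\<close> by (simp add: regular_method_def)
  have row_sums: "(\<lambda>i. \<Sum>j. a i (Suc j)) \<longlonglongrightarrow> 1"
    using \<open>regular_method a\<close> by (simp add: regular_method_def)
  have "AE \<omega> in M. X (Suc n) \<omega> \<in> real_xreals" for n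
    using assms(4)[of "Suc n"] by (intro AE_if_measure_eq_1) simp
  then have "AE \<omega> in M. \<forall>n. X (Suc n) \<omega> \<in> real_xreals"
    by (simp add: AE_all_countable)
  moreover have "AE \<omega> in M. Xinf \<omega> \<in> real_xreals"
    by (rule AE_if_measure_eq_1[OF assms(5)])
  ultimately show ?thesis
    using assms(7)
  proof eventually_elim
    case (elim \<omega>)
    then have "\<forall>n. \<exists>r. X (Suc n) \<omega> = r *\<^sub>R 1" and "\<exists>r. Xinf \<omega> = r *\<^sub>R 1"
      by (auto simp: real_xreals_def)
    then obtain x l where x: "\<And>n. X (Suc n) \<omega> = x n *\<^sub>R 1" and l: "Xinf \<omega> = l *\<^sub>R 1"
      by metis
    have "(\<lambda>n. X (Suc n) \<omega>) \<longlonglongrightarrow> Xinf \<omega>"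
      using elim(3) by (rule LIMSEQ_Suc)
    then have lim: "x \<longlonglongrightarrow> l"
      by (simp add: x l tendsto_real_xreal_iff)
    have sums: "(\<lambda>j. a n (Suc j) *\<^sub>R X (Suc j) \<omega>) sums ((\<Sum>j. a n (Suc j) * x j) *\<^sub>R 1)"
      if "n \<ge> 1" for n
    proof -
      have "summable (\<lambda>j. a n (Suc j) * x j)"
        using rows that summable_rabs_cancel[OF summable_mult_convergent[OF _ lim]] by auto
      then show ?thesis
        using sums_real_xreal[OF summable_sums] by (simp add: x)
    qed
    \<comment> \<open>Row 0 is arbitrary and its series may diverge, so the rows are controlled only
      eventually.\<close>
    have "(\<lambda>n. \<Sum>j. a n (Suc j) * x j) \<longlonglongrightarrow> l"
      using rows
      by (intro silverman_toeplitz[OF eventually_sequentiallyI[of 1] cols row_sums lim]) blast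
    then have "(\<lambda>n. (\<Sum>j. a n (Suc j) * x j) *\<^sub>R (1::xreal)) \<longlonglongrightarrow> Xinf \<omega>"
      by (simp add: l tendsto_real_xreal_iff)
    moreover have "\<forall>\<^sub>F n in sequentially.
        (\<Sum>j. a n (Suc j) * x j) *\<^sub>R 1 = (\<Sum>j. a n (Suc j) *\<^sub>R X (Suc j) \<omega>)"
      using sums by (intro eventually_sequentiallyI[of 1] sums_unique)
    ultimately have "(\<lambda>n. \<Sum>j. a n (Suc j) *\<^sub>R X (Suc j) \<omega>) \<longlonglongrightarrow> Xinf \<omega>"
      by (rule Lim_transform_eventually)
    with sums show ?case
      by (blast intro: sums_summable)
  qed
qed

end
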